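(* There are constants $\alpha, c>0$, depending only on the dimension $n$, such that for every cube $Q\subset\mathbb{R}^n$, every real-valued $f\in L^\infty_c(\mathbb{R}^n)$ with $\operatorname{supp}(f)\subseteq Q$, and every median value $m_f(Q)$ of $f$ over $Q$, $$|\{x\in Q: |f(x)-m_f(Q)|>t\,M^{\#}_{2^{-n-2};Q}f(x)\}|\le c\,e^{-\alpha t}|Q|,\qquad t>0.$$
   Context: Cubes have sides parallel to the coordinate axes; $|E|$ is Lebesgue measure; $L^\infty_c(\mathbb{R}^n)$ is the space of bounded functions with compact support. A median value $m_f(Q)$ of $f$ over a cube $Q$ is a (possibly non-unique) real number such that $|\{x\in Q: f(x)>m_f(Q)\}|\le |Q|/2$ and $|\{x\in Q: f(x)<m_f(Q)\}|\le |Q|/2$. For $0<\lambda<1$, the mean local oscillation of a measurable $f$ on a cube $Q$ is $\omega_\lambda(f;Q)=\inf_{c\in\mathbb{R}}\big((f-c)\chi_Q\big)^*(\lambda|Q|)$, where $g^*$ is the usual non-increasing rearrangement, $g^*(s)=\inf\{u\ge 0: |\{|g|>u\}|\le s\}$. For a fixed cube $Q_0$, the local sharp maximal function is $M^{\#}_{\lambda;Q_0}f(x)=\sup_{x\in P\subset Q_0}\omega_\lambda(f;P)$, the supremum being over all cubes $P$ contained in $Q_0$ with $x\in P$. *)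

theory Defs
  imports "HOL-Analysis.Analysis"
begin

definition is_cube :: "(real ^ 'n) set \<Rightarrow> bool" where
  "is_cube Q \<longleftrightarrow> (\<exists>a l. l > 0 \<and> Q = cbox a (a + vec l))"

text \<open>The essential support: unlike the closure of the set where \<open>f\<close> does not vanish, it does not
  change when \<open>f\<close> is modified on a null set, as is appropriate for elements of \<open>L\<^sup>\<infinity>\<close>.\<close>

definition ess_support :: "(real ^ 'n \<Rightarrow> real) \<Rightarrow> (real ^ 'n) set" where
  "ess_support f = - \<Union>{U. open U \<and> (AE x in lebesgue. x \<in> U \<longrightarrow> f x = 0)}"

definition Linf_c :: "(real ^ 'n \<Rightarrow> real) set" where
  "Linf_c = {f \<in> borel_measurable lebesgue.
     (\<exists>B. AE x in lebesgue. \<bar>f x\<bar> \<le> B) \<and> compact (ess_support f)}"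

definition is_median :: "(real ^ 'n \<Rightarrow> real) \<Rightarrow> (real ^ 'n) set \<Rightarrow> real \<Rightarrow> bool" where
  "is_median f Q m \<longleftrightarrow>
     measure lebesgue {x \<in> Q. f x > m} \<le> measure lebesgue Q / 2 \<and>
     measure lebesgue {x \<in> Q. f x < m} \<le> measure lebesgue Q / 2"

text \<open>The next three quantities take values in \<^typ>\<open>ennreal\<close>, so that the infimum of the empty
  set is \<open>\<infinity>\<close> and suprema always exist.\<close>

definition rearrangement :: "(real ^ 'n \<Rightarrow> real) \<Rightarrow> real \<Rightarrow> ennreal" where
  "rearrangement g s =
     (INF u \<in> {u. 0 \<le> u \<and> emeasure lebesgue {x. \<bar>g x\<bar> > u} \<le> ennreal s}. ennreal u)"

definition local_osc :: "real \<Rightarrow> (real ^ 'n \<Rightarrow> real) \<Rightarrow> (real ^ 'n) set \<Rightarrow> ennreal" where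
  "local_osc r f Q =
     (INF c. rearrangement (\<lambda>x. (f x - c) * indicator Q x) (r * measure lebesgue Q))"

definition local_sharp_max ::
    "real \<Rightarrow> (real ^ 'n) set \<Rightarrow> (real ^ 'n \<Rightarrow> real) \<Rightarrow> real ^ 'n \<Rightarrow> ennreal" where
  "local_sharp_max r Q\<^sub>0 f x =
     (SUP P \<in> {P. is_cube P \<and> x \<in> P \<and> P \<subseteq> Q\<^sub>0}. local_osc r f P)"

end

theory Submission
  imports Defs
begin

text \<open>The idea is a stopping-time argument with medians in place of averages. Write \<open>\<omega>(Q)\<close> for the local
  oscillation at level \<open>2 ^ (-n-2)\<close>. If \<open>m\<close> is a median of \<open>f\<close> over \<open>Q\<close>, then
  \<open>|f - m| \<le> 2 \<omega>(Q)\<close> off a set \<open>E\<close> of measure at most \<open>2 ^ (-n-2) |Q|\<close>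
  (\<open>measure_exceeds_twice_osc_le\<close>). A Calderon--Zygmund decomposition of \<open>E\<close> at height
  \<open>3/8 2 ^ (-n)\<close> (\<open>calderon_zygmund_cubes\<close>) covers almost all of \<open>E\<close> by dyadic subcubes \<open>P\<close> of \<open>Q\<close>
  of total measure at most \<open>2/3 |Q|\<close>, each meeting \<open>E\<close> in at most \<open>3/8\<close> of its measure. Hence \<open>f\<close> is within
  \<open>2 \<omega>(Q)\<close> of \<open>m\<close> on more than half of \<open>P\<close>, and so is every median \<open>m'\<close> of \<open>f\<close> over \<open>P\<close>
  (\<open>stopping_cubes_medians_close\<close>).

  Repeating this inside the cubes \<open>P\<close> with the medians \<open>m'\<close>, after \<open>k\<close> rounds one has a
  set of measure at most \<open>(2/3) ^ k |Q|\<close> off which \<open>|f - m|\<close> is at most a sum of \<open>k\<close> terms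
  \<open>2 \<omega>(P)\<close> over cubes \<open>P\<close> with \<open>x \<in> P \<subseteq> Q\<close>, hence at most \<open>2 k\<close> times
  the sharp maximal function at \<open>x\<close> (\<open>osc_bound_outside_exceptional_set\<close>). Choosing \<open>k\<close> to be the integer part
  of \<open>t/2\<close> gives the exponential decay.\<close>

section \<open>Measure of level sets and of disjoint unions\<close>

lemma measurable_level_sets:
  assumes "f \<in> borel_measurable lebesgue" "Q \<in> lmeasurable"
  shows "{x \<in> Q. f x < (c::real)} \<in> lmeasurable" "{x \<in> Q. f x > c} \<in> lmeasurable"
    "{x \<in> Q. \<bar>f x - c\<bar> > d} \<in> lmeasurable"
proof -
  note [measurable] = assms(1)
  have "{x \<in> space lebesgue. f x < c} \<in> sets lebesgue"
    "{x \<in> space lebesgue. f x > c} \<in> sets lebesgue"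
    "{x \<in> space lebesgue. \<bar>f x - c\<bar> > d} \<in> sets lebesgue"
    by measurable
  then have 1: "{x. f x < c} \<in> sets lebesgue" "{x. f x > c} \<in> sets lebesgue"
    "{x. \<bar>f x - c\<bar> > d} \<in> sets lebesgue"
    by simp_all
  have "{x \<in> Q. f x < c} = Q \<inter> {x. f x < c}" "{x \<in> Q. f x > c} = Q \<inter> {x. f x > c}"
     "{x \<in> Q. \<bar>f x - c\<bar> > d} = Q \<inter> {x. \<bar>f x - c\<bar> > d}" by auto
  then show "{x \<in> Q. f x < (c::real)} \<in> lmeasurable" "{x \<in> Q. f x > c} \<in> lmeasurable"
    "{x \<in> Q. \<bar>f x - c\<bar> > d} \<in> lmeasurable"
    using fmeasurable_Int_fmeasurable[OF assms(2) 1(1)] fmeasurable_Int_fmeasurable[OF assms(2) 1(2)]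
      fmeasurable_Int_fmeasurable[OF assms(2) 1(3)] by simp_all
qed

lemma measure_incseq_Union_le:
  fixes A :: "nat \<Rightarrow> 'a set"
  assumes "\<And>n. A n \<in> sets M" "incseq A" "(\<Union>n. A n) \<in> fmeasurable M" "\<And>n. measure M (A n) \<le> b"
  shows "measure M (\<Union>n. A n) \<le> b"
proof -
  have "(\<lambda>n. measure M (A n)) \<longlonglongrightarrow> measure M (\<Union>n. A n)"
    using assms by (intro Lim_measure_incseq) (auto simp: fmeasurable_def)
  then show ?thesis
    using assms(4) by (intro LIMSEQ_le_const2) auto
qed

text \<open>Local estimates on the members of a countable disjoint family add up. The sets compared may be
  arbitrary parts \<open>F A\<close> and \<open>G A\<close> of each member \<open>A\<close>: the density bounds below compare
  \<open>A\<close> with its intersection with a given set, in either direction, and the induction compares an exceptional part of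
  \<open>A\<close> with \<open>A\<close> itself. The common measurable bound \<open>B\<close> keeps all measures finite.\<close>
lemma measure_disjoint_Union_le:
  assumes C: "countable \<C>" "disjoint \<C>" and B: "B \<in> fmeasurable M" "\<And>A. A \<in> \<C> \<Longrightarrow> A \<subseteq> B"
    and F: "\<And>A. A \<in> \<C> \<Longrightarrow> F A \<in> sets M \<and> F A \<subseteq> A"
    and G: "\<And>A. A \<in> \<C> \<Longrightarrow> G A \<in> sets M \<and> G A \<subseteq> A"
    and le: "\<And>A. A \<in> \<C> \<Longrightarrow> measure M (F A) \<le> r * measure M (G A)" and r: "r \<ge> 0"
  shows "measure M (\<Union>A\<in>\<C>. F A) \<le> r * measure M (\<Union>A\<in>\<C>. G A)"
proof -
  have fm: "F A \<in> fmeasurable M" "G A \<in> fmeasurable M" if "A \<in> \<C>" for A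
    using F[OF that] G[OF that] B(2)[OF that] by (auto intro: fmeasurableI2[OF B(1)])
  have Fs: "(\<Union>A\<in>\<C>. F A) \<in> sets M" and Gs: "(\<Union>A\<in>\<C>. G A) \<in> sets M"
    using C(1) F G by (auto intro!: sets.countable_UN')
  have sub: "(\<Union>A\<in>\<C>. F A) \<subseteq> B" "(\<Union>A\<in>\<C>. G A) \<subseteq> B" using F G B(2) by blast+
  have FM: "(\<Union>A\<in>\<C>. F A) \<in> fmeasurable M" "(\<Union>A\<in>\<C>. G A) \<in> fmeasurable M"
    using fmeasurableI2[OF B(1) sub(1) Fs] fmeasurableI2[OF B(1) sub(2) Gs] .
  have disjI: "disjoint_family_on H \<C>" if "\<And>A. A \<in> \<C> \<Longrightarrow> H A \<subseteq> A" for H :: "'a set \<Rightarrow> 'a set"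
    unfolding disjoint_family_on_def
  proof (intro ballI impI)
    fix A B assume "A \<in> \<C>" "B \<in> \<C>" "A \<noteq> B"
    then have "A \<inter> B = {}" using C(2) by (auto simp: disjoint_def)
    then show "H A \<inter> H B = {}" using that[OF \<open>A \<in> \<C>\<close>] that[OF \<open>B \<in> \<C>\<close>] by auto
  qed
  have disj: "disjoint_family_on F \<C>" "disjoint_family_on G \<C>"
    using disjI F G by simp_all
  have "emeasure M (\<Union>A\<in>\<C>. F A) = (\<integral>\<^sup>+A. emeasure M (F A) \<partial>count_space \<C>)"
    using F C disj by (intro emeasure_UN_countable) auto
  also have "\<dots> \<le> (\<integral>\<^sup>+A. ennreal r * emeasure M (G A) \<partial>count_space \<C>)"
  proof (rule nn_integral_mono)
    fix A assume "A \<in> space (count_space \<C>)"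
    then have "A \<in> \<C>" by simp
    then show "emeasure M (F A) \<le> ennreal r * emeasure M (G A)"
      using le[of A] fm[of A] r
      by (simp add: emeasure_eq_measure2 ennreal_mult[symmetric] ennreal_leI)
  qed
  also have "\<dots> = ennreal r * (\<integral>\<^sup>+A. emeasure M (G A) \<partial>count_space \<C>)"
    by (rule nn_integral_cmult) simp
  also have "(\<integral>\<^sup>+A. emeasure M (G A) \<partial>count_space \<C>) = emeasure M (\<Union>A\<in>\<C>. G A)"
    using G C disj by (intro emeasure_UN_countable[symmetric]) auto
  finally show ?thesis
    using FM r by (simp add: emeasure_eq_measure2 ennreal_mult[symmetric] ennreal_le_iff)
qed

section \<open>Medians and oscillation\<close>

text \<open>The supremum of the levels below which \<open>f\<close> lies on at most half of \<open>Q\<close> is a median: the level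
  sets \<open>{f < m}\<close> and \<open>{f > m}\<close> are increasing unions of level sets to which the
  defining property of \<open>m\<close> applies. The supremum exists because \<open>f\<close> is finite everywhere and \<open>Q\<close> has finite positive measure.\<close>
lemma median_exists:
  fixes f :: "real ^ 'n \<Rightarrow> real"
  assumes f: "f \<in> borel_measurable lebesgue" and Q: "Q \<in> lmeasurable" "measure lebesgue Q > 0"
  obtains m where "is_median f Q m"
proof -
  let ?F = "\<lambda>u. measure lebesgue {x \<in> Q. f x < u}"
  let ?h = "measure lebesgue Q / 2"
  note lm = measurable_level_sets[OF f Q(1)]
  have mono: "?F u \<le> ?F v" if "u \<le> v" for u v
    using that by (intro measure_mono_fmeasurable lm fmeasurableD) auto
  define S where "S = {u. ?F u \<le> ?h}"
  have down: "u \<in> S" if "v \<in> S" "u \<le> v" for u v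
    using mono[OF that(2)] that(1) by (simp add: S_def)
  have "\<exists>u. ?F u > ?h"
  proof (rule ccontr)
    assume "\<not> ?thesis"
    then have le: "?F (real n) \<le> ?h" for n by (simp add: not_less)
    have eq: "(\<Union>n. {x \<in> Q. f x < real n}) = Q"
      using reals_Archimedean2 by auto
    have "measure lebesgue (\<Union>n. {x \<in> Q. f x < real n}) \<le> ?h"
      using le Q by (intro measure_incseq_Union_le fmeasurableD lm)
        (auto simp: eq intro!: incseq_SucI)
    then show False using Q by (simp add: eq)
  qed
  then obtain b where b: "b \<notin> S" unfolding S_def mem_Collect_eq not_le by blast
  have bdd: "bdd_above S"
    using down b by (intro bdd_aboveI[of _ b]) (meson linear)
  have "S \<noteq> {}"
  proof
    assume "S = {}"
    then have gt: "?F u > ?h" for u by (auto simp: S_def not_le)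
    have eq: "(\<Union>n. {x \<in> Q. f x > - real n}) = Q"
    proof -
      have "\<exists>n. - real n < f x" for x
        using reals_Archimedean2[of "- f x"] by (metis minus_less_iff)
      then show ?thesis by auto
    qed
    have le: "measure lebesgue {x \<in> Q. f x > - real n} \<le> ?h" for n
    proof -
      have "measure lebesgue {x \<in> Q. f x > - real n} \<le> measure lebesgue (Q - {x \<in> Q. f x < - real n})"
        by (intro measure_mono_fmeasurable fmeasurableD lm fmeasurable.Diff Q) auto
      also have "\<dots> = measure lebesgue Q - ?F (- real n)"
        by (intro measurable_measure_Diff Q fmeasurableD lm) auto
      finally show ?thesis using gt[of "- real n"] by simp
    qed
    have "measure lebesgue (\<Union>n. {x \<in> Q. f x > - real n}) \<le> ?h"
      using le Q by (intro measure_incseq_Union_le fmeasurableD lm)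
        (auto simp: eq intro!: incseq_SucI)
    then show False using Q by (simp add: eq)
  qed
  define m where "m = Sup S"
  have below: "u \<in> S" if "u < m" for u
    using less_cSup_iff[OF \<open>S \<noteq> {}\<close> bdd] that down unfolding m_def by (meson less_imp_le)
  have above: "u \<notin> S" if "m < u" for u
    using cSup_upper[OF _ bdd, of u] that unfolding m_def by auto
  have arch: "\<exists>n. e > 1 / real (Suc n)" if "e > 0" for e :: real
    using that nat_approx_posE by metis
  have pos: "1 / real (Suc n) > 0" for n by simp
  have inc: "1 / real (Suc (Suc n)) \<le> 1 / real (Suc n)" for n by (simp add: frac_le)
  have "is_median f Q m"
    unfolding is_median_def
  proof
    have eq: "(\<Union>n. {x \<in> Q. f x > m + 1 / real (Suc n)}) = {x \<in> Q. f x > m}"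
    proof -
      have "\<exists>n. m + 1 / real (Suc n) < f x" if "m < f x" for x
        using arch[of "f x - m"] that by (auto simp: algebra_simps)
      moreover have "m < f x" if "m + 1 / real (Suc n) < f x" for x n
        using that pos[of n] by linarith
      ultimately show ?thesis by blast
    qed
    have le: "measure lebesgue {x \<in> Q. f x > m + 1 / real (Suc n)} \<le> ?h" for n
    proof -
      have "measure lebesgue {x \<in> Q. f x > m + 1 / real (Suc n)}
          \<le> measure lebesgue (Q - {x \<in> Q. f x < m + 1 / real (Suc n)})"
        by (intro measure_mono_fmeasurable fmeasurableD lm fmeasurable.Diff Q) auto
      also have "\<dots> = measure lebesgue Q - ?F (m + 1 / real (Suc n))"
        by (intro measurable_measure_Diff Q fmeasurableD lm) auto
      finally show ?thesis
        using above[of "m + 1 / real (Suc n)"] by (simp add: S_def)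
    qed
    have "measure lebesgue (\<Union>n. {x \<in> Q. f x > m + 1 / real (Suc n)}) \<le> ?h"
    proof (intro measure_incseq_Union_le fmeasurableD lm le incseq_SucI)
      show "{x \<in> Q. m + 1 / real (Suc n) < f x} \<subseteq> {x \<in> Q. m + 1 / real (Suc (Suc n)) < f x}" for n
        using inc[of n] by auto
      show "(\<Union>n. {x \<in> Q. m + 1 / real (Suc n) < f x}) \<in> lmeasurable"
        unfolding eq by (rule lm)
    qed
    then show "measure lebesgue {x \<in> Q. f x > m} \<le> ?h" by (simp only: eq)
  next
    have eq: "(\<Union>n. {x \<in> Q. f x < m - 1 / real (Suc n)}) = {x \<in> Q. f x < m}"
    proof -
      have "\<exists>n. f x < m - 1 / real (Suc n)" if "m > f x" for x
        using arch[of "m - f x"] that by (auto simp: algebra_simps)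
      moreover have "f x < m" if "f x < m - 1 / real (Suc n)" for x n
        using that pos[of n] by linarith
      ultimately show ?thesis by blast
    qed
    have "measure lebesgue (\<Union>n. {x \<in> Q. f x < m - 1 / real (Suc n)}) \<le> ?h"
    proof (intro measure_incseq_Union_le fmeasurableD lm incseq_SucI)
      show "{x \<in> Q. f x < m - 1 / real (Suc n)} \<subseteq> {x \<in> Q. f x < m - 1 / real (Suc (Suc n))}" for n
        using inc[of n] by auto
      show "(\<Union>n. {x \<in> Q. f x < m - 1 / real (Suc n)}) \<in> lmeasurable"
        unfolding eq by (rule lm)
      show "?F (m - 1 / real (Suc n)) \<le> ?h" for n
        using below[of "m - 1 / real (Suc n)"] by (simp add: S_def)
    qed
    then show "measure lebesgue {x \<in> Q. f x < m} \<le> ?h" by (simp only: eq)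
  qed
  then show thesis by (rule that)
qed

text \<open>A median cannot be separated from the values taken on strictly more than half of \<open>Q\<close>. Strictness
  matters: values taken on exactly half of \<open>Q\<close> may lie at a distance from some median.\<close>
lemma median_close_if_majority:
  assumes f: "f \<in> borel_measurable lebesgue" and Q: "Q \<in> lmeasurable" and m: "is_median f Q m"
    and A: "A \<in> lmeasurable" "A \<subseteq> Q" "measure lebesgue A > measure lebesgue Q / 2"
    and close: "\<And>x. x \<in> A \<Longrightarrow> \<bar>f x - c\<bar> \<le> u"
  shows "\<bar>m - c\<bar> \<le> u"
proof (rule ccontr)
  assume "\<not> ?thesis"
  then consider "m > c + u" | "m < c - u" by linarith
  then show False
  proof cases
    case 1
    have "f x < m" if "x \<in> A" for x using close[OF that] 1 by linarith
    then have "measure lebesgue A \<le> measure lebesgue {x \<in> Q. f x < m}"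
      using A(2) by (intro measure_mono_fmeasurable measurable_level_sets[OF f Q] fmeasurableD[OF A(1)]) auto
    then show False using m A(3) by (simp add: is_median_def)
  next
    case 2
    have "f x > m" if "x \<in> A" for x using close[OF that] 2 by linarith
    then have "measure lebesgue A \<le> measure lebesgue {x \<in> Q. f x > m}"
      using A(2) by (intro measure_mono_fmeasurable measurable_level_sets[OF f Q] fmeasurableD[OF A(1)]) auto
    then show False using m A(3) by (simp add: is_median_def)
  qed
qed

text \<open>If \<open>f\<close> is within \<open>v\<close> of a constant \<open>c\<close> off a set of measure at most \<open>r |Q|\<close>, the majority
  principle puts \<open>m\<close> within \<open>v\<close> of \<open>c\<close>, so \<open>f\<close> is within \<open>2 v\<close> of \<open>m\<close> off the same set. The oscillation is
  an infimum of such \<open>v\<close> and need not be attained, hence the passage through levels \<open>u\<close> strictly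
  above it and the monotone limit at the end.\<close>
lemma measure_exceeds_twice_osc_le:
  fixes f :: "real ^ 'n \<Rightarrow> real"
  assumes f: "f \<in> borel_measurable lebesgue" and Q: "Q \<in> lmeasurable" "measure lebesgue Q > 0"
    and m: "is_median f Q m" and r: "0 \<le> r" "r < 1/2"
  defines "E \<equiv> {x \<in> Q. ennreal \<bar>f x - m\<bar> > 2 * local_osc r f Q}"
  shows "E \<in> lmeasurable" "measure lebesgue E \<le> r * measure lebesgue Q"
proof -
  note lm = measurable_level_sets[OF f Q(1)]
  have "E \<in> lmeasurable \<and> measure lebesgue E \<le> r * measure lebesgue Q"
  proof (cases "local_osc r f Q")
    case (real w)
    have bound: "measure lebesgue {x \<in> Q. \<bar>f x - m\<bar> > 2 * u} \<le> r * measure lebesgue Q" if u: "u > w" for u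
    proof -
      have "local_osc r f Q < ennreal u" using real u by (simp add: ennreal_less_iff)
      then obtain c where "rearrangement (\<lambda>x. (f x - c) * indicator Q x) (r * measure lebesgue Q) < ennreal u"
        unfolding local_osc_def INF_less_iff by blast
      then obtain v where v: "v \<ge> 0" "ennreal v < ennreal u"
        "emeasure lebesgue {x. \<bar>(f x - c) * indicator Q x\<bar> > v} \<le> ennreal (r * measure lebesgue Q)"
        unfolding rearrangement_def INF_less_iff by blast
      define B where "B = {x \<in> Q. \<bar>f x - c\<bar> > v}"
      have B: "{x. \<bar>(f x - c) * indicator Q x\<bar> > v} = B"
        using v(1) by (auto simp: B_def indicator_def split: if_splits)
      have Blm: "B \<in> lmeasurable" unfolding B_def by (rule lm)
      have mB: "measure lebesgue B \<le> r * measure lebesgue Q"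
        using v(3) r Blm unfolding B by (simp add: emeasure_eq_measure2 ennreal_le_iff)
      have "measure lebesgue (Q - B) = measure lebesgue Q - measure lebesgue B"
        by (intro measurable_measure_Diff Q fmeasurableD Blm) (auto simp: B_def)
      moreover have "r * measure lebesgue Q < 1/2 * measure lebesgue Q"
        using r Q by (intro mult_strict_right_mono) auto
      ultimately have "measure lebesgue (Q - B) > measure lebesgue Q / 2"
        using mB by linarith
      moreover have "Q - B \<in> lmeasurable" using Q(1) Blm by (intro fmeasurable.Diff)
      moreover have "\<bar>f x - c\<bar> \<le> v" if "x \<in> Q - B" for x
        using that by (auto simp: B_def)
      ultimately have "\<bar>m - c\<bar> \<le> v"
        using median_close_if_majority[OF f Q(1) m, of "Q - B" c v] by blast
      moreover have "v < u" using v by (simp add: ennreal_less_iff)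
      ultimately have "{x \<in> Q. \<bar>f x - m\<bar> > 2 * u} \<subseteq> B"
        by (auto simp: B_def)
      then have "measure lebesgue {x \<in> Q. \<bar>f x - m\<bar> > 2 * u} \<le> measure lebesgue B"
        by (intro measure_mono_fmeasurable Blm fmeasurableD lm)
      with mB show ?thesis by simp
    qed
    have "2 * local_osc r f Q = ennreal (2 * w)" using real by (simp add: ennreal_mult)
    then have E: "E = {x \<in> Q. \<bar>f x - m\<bar> > 2 * w}"
      using real by (auto simp: E_def ennreal_less_iff)
    have pos: "1 / real (Suc n) > 0" for n by simp
    have eq: "(\<Union>n. {x \<in> Q. \<bar>f x - m\<bar> > 2 * (w + 1 / real (Suc n))}) = E"
    proof -
      have "\<exists>n. 2 * (w + 1 / real (Suc n)) < \<bar>f x - m\<bar>" if "2 * w < \<bar>f x - m\<bar>" for x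
        using nat_approx_posE[of "\<bar>f x - m\<bar> / 2 - w"] that by (auto simp: algebra_simps)
      moreover have "2 * w < \<bar>f x - m\<bar>" if "2 * (w + 1 / real (Suc n)) < \<bar>f x - m\<bar>" for x n
        using less_trans[OF _ that, of "2 * w"] pos[of n] by simp
      ultimately show ?thesis unfolding E by blast
    qed
    have Elm: "E \<in> lmeasurable" unfolding E by (rule lm)
    have "measure lebesgue (\<Union>n. {x \<in> Q. \<bar>f x - m\<bar> > 2 * (w + 1 / real (Suc n))}) \<le> r * measure lebesgue Q"
    proof (intro measure_incseq_Union_le fmeasurableD lm incseq_SucI)
      have inc: "1 / real (Suc (Suc n)) \<le> 1 / real (Suc n)" for n by (simp add: frac_le)
      show "{x \<in> Q. 2 * (w + 1 / real (Suc n)) < \<bar>f x - m\<bar>}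
          \<subseteq> {x \<in> Q. 2 * (w + 1 / real (Suc (Suc n))) < \<bar>f x - m\<bar>}" for n
        using inc[of n] by auto
      show "(\<Union>n. {x \<in> Q. 2 * (w + 1 / real (Suc n)) < \<bar>f x - m\<bar>}) \<in> lmeasurable"
        unfolding eq by (rule Elm)
      show "measure lebesgue {x \<in> Q. 2 * (w + 1 / real (Suc n)) < \<bar>f x - m\<bar>} \<le> r * measure lebesgue Q" for n
        by (rule bound) simp
    qed
    then show ?thesis using Elm by (simp only: eq)
  next
    case top
    \<comment> \<open>An infinite oscillation makes the strict inequality that defines \<open>E\<close> impossible.\<close>
    then have "E = {}" by (simp add: E_def)
    then show ?thesis using r by simp
  qed
  then show "E \<in> lmeasurable" "measure lebesgue E \<le> r * measure lebesgue Q" by auto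
qed

section \<open>Dyadic cells\<close>

text \<open>The dyadic cell of generation \<open>k\<close> of the grid with origin \<open>a\<close> and mesh \<open>l\<close> that contains
  \<open>x\<close>. Describing it as the set of points with the same integer parts makes the cells of one
  generation literally disjoint, which closed cubes are not; the closed cube is recovered up to a null set.\<close>
definition cell :: "real ^ 'n \<Rightarrow> real \<Rightarrow> nat \<Rightarrow> real ^ 'n \<Rightarrow> (real ^ 'n) set" where
  "cell a l k x = {y. \<forall>i. \<lfloor>2 ^ k * ((y $ i - a $ i) / l)\<rfloor> = \<lfloor>2 ^ k * ((x $ i - a $ i) / l)\<rfloor>}"

definition cell_corner :: "real ^ 'n \<Rightarrow> real \<Rightarrow> nat \<Rightarrow> real ^ 'n \<Rightarrow> real ^ 'n" where
  "cell_corner a l k x = (\<chi> i. a $ i + l / 2 ^ k * of_int \<lfloor>2 ^ k * ((x $ i - a $ i) / l)\<rfloor>)"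

lemma mem_cell_self: "x \<in> cell a l k x"
  by (simp add: cell_def)

lemma cell_eq_if_mem: "y \<in> cell a l k x \<Longrightarrow> cell a l k y = cell a l k x"
  by (auto simp: cell_def)

lemma floor_two_power_mult_eq:
  fixes u :: real
  assumes "j \<le> k"
  shows "\<lfloor>2 ^ j * u\<rfloor> = \<lfloor>2 ^ k * u\<rfloor> div 2 ^ (k - j)"
proof -
  have "(2::real) ^ k = 2 ^ j * 2 ^ (k - j)" using assms by (simp flip: power_add)
  then have "2 ^ j * u = 2 ^ k * u / real_of_int (2 ^ (k - j))" by simp
  then show ?thesis
    by (simp only: floor_divide_real_eq_div[of "2 ^ (k - j)" "2 ^ k * u"] zero_le_power zero_le_numeral)
qed

lemma cell_antimono: "j \<le> k \<Longrightarrow> cell a l k x \<subseteq> cell a l j x"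
  by (auto simp: cell_def floor_two_power_mult_eq[of j k] simp del: times_divide_eq_right)

lemma box_subset_cell_subset_cbox:
  assumes "l > 0"
  shows "box (cell_corner a l k x) (cell_corner a l k x + vec (l / 2 ^ k)) \<subseteq> cell a l k x"
    and "cell a l k x \<subseteq> cbox (cell_corner a l k x) (cell_corner a l k x + vec (l / 2 ^ k))"
proof -
  define s where "s = l / 2 ^ k"
  have s: "s > 0" using assms by (simp add: s_def)
  have eq: "2 ^ k * (v / l) = v / s" for v using assms by (simp add: s_def field_simps)
  have "\<lfloor>(y - a) / s\<rfloor> = z" if "a + s * of_int z < y" "y < a + s * of_int z + s" for y a z
    using that s by (intro floor_unique) (simp_all add: field_simps)
  then show "box (cell_corner a l k x) (cell_corner a l k x + vec (l / 2 ^ k)) \<subseteq> cell a l k x"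
    unfolding cell_def cell_corner_def eq s_def[symmetric] by (auto simp: mem_box_cart)
  have "a + s * of_int z \<le> y \<and> y \<le> a + s * of_int z + s" if "\<lfloor>(y - a) / s\<rfloor> = z" for y a :: real and z
  proof -
    have "of_int z \<le> (y - a) / s" "(y - a) / s < of_int z + 1"
      using that by linarith+
    then show ?thesis using s by (simp add: field_simps)
  qed
  then show "cell a l k x \<subseteq> cbox (cell_corner a l k x) (cell_corner a l k x + vec (l / 2 ^ k))"
    unfolding cell_def cell_corner_def eq s_def[symmetric] subset_iff mem_box_cart mem_Collect_eq
      vector_add_component vec_lambda_beta vec_component
    by blast
qed

lemma measure_cube:
  fixes c :: "real ^ 'n"
  assumes "s > 0"
  shows "measure lebesgue (cbox c (c + vec s)) = s ^ CARD('n)"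
proof -
  have "cbox c (c + vec s) \<noteq> {}" using assms by (simp add: interval_ne_empty_cart less_imp_le)
  then have "measure lborel (cbox c (c + vec s)) = s ^ CARD('n)" by (simp add: content_cbox_cart)
  then show ?thesis by (simp add: measure_completion)
qed

lemma cell_lmeasurable:
  fixes a :: "real ^ 'n"
  assumes "l > 0"
  shows "cell a l k x \<in> lmeasurable" "measure lebesgue (cell a l k x) = (l / 2 ^ k) ^ CARD('n)"
proof -
  define s c where "s = l / 2 ^ k" and "c = cell_corner a l k x"
  have s: "s > 0" using assms by (simp add: s_def)
  note sub = box_subset_cell_subset_cbox[OF assms, of a k x, folded s_def, folded c_def]
  have neg: "negligible (sym_diff (cell a l k x) (cbox c (c + vec s)))"
    by (rule negligible_subset[OF negligible_frontier_interval[of c "c + vec s"]]) (use sub in auto)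
  then have neg': "negligible (sym_diff (cbox c (c + vec s)) (cell a l k x))"
    by (simp add: Un_commute)
  show "cell a l k x \<in> lmeasurable"
    by (rule lmeasurable_negligible_symdiff[OF lmeasurable_cbox neg'])
  show "measure lebesgue (cell a l k x) = (l / 2 ^ k) ^ CARD('n)"
    using measure_negligible_symdiff[OF lmeasurable_cbox neg'] measure_cube[OF s, of c]
    by (simp add: s_def)
qed

text \<open>Any two points of a cell differ by at most \<open>l / 2 ^ k\<close> in each coordinate, hence by at most
  \<open>n l / 2 ^ k\<close> in norm.\<close>
lemma cell_subset_open:
  fixes a :: "real ^ 'n"
  assumes "l > 0" "open U" "x \<in> U"
  shows "\<exists>k. cell a l k x \<subseteq> U"
proof -
  obtain e where e: "e > 0" "ball x e \<subseteq> U" using assms open_contains_ball by metis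
  obtain k where k: "(1/2::real) ^ k < e / (l * CARD('n))"
    using real_arch_pow_inv[of "e / (l * CARD('n))" "1/2"] e assms(1) by auto
  have "cell a l k x \<subseteq> ball x e"
  proof
    fix y assume y: "y \<in> cell a l k x"
    define c where "c = cell_corner a l k x"
    have "y \<in> cbox c (c + vec (l / 2 ^ k))" "x \<in> cbox c (c + vec (l / 2 ^ k))"
      using box_subset_cell_subset_cbox(2)[OF assms(1), of a k x] y mem_cell_self[of x a l k] 
      unfolding c_def by blast+
    then have "\<bar>(x - y) $ i\<bar> \<le> l / 2 ^ k" for i
      by (auto simp: mem_box_cart abs_le_iff) (smt (verit))+
    then have "(\<Sum>i\<in>UNIV. \<bar>(x - y) $ i\<bar>) \<le> CARD('n) * (l / 2 ^ k)"
      by (intro sum_bounded_above) auto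
    then have "norm (x - y) \<le> CARD('n) * (l / 2 ^ k)"
      using norm_le_l1_cart[of "x - y"] by linarith
    also have "\<dots> < e"
      using k assms(1) by (simp add: field_simps power_one_over)
    finally show "y \<in> ball x e" by (simp add: dist_norm)
  qed
  with e show ?thesis by blast
qed

lemma half_open_cube:
  assumes "l > 0" 
  shows "cell a l 0 a \<subseteq> cbox a (a + vec l)"
    and "negligible (cbox a (a + vec l) - cell a l 0 a)"
proof -
  have c: "cell_corner a l 0 a = a" by (simp add: cell_corner_def vec_eq_iff)
  note sub = box_subset_cell_subset_cbox[OF assms, of a 0 a, unfolded c, simplified]
  show "cell a l 0 a \<subseteq> cbox a (a + vec l)" by (rule sub)
  show "negligible (cbox a (a + vec l) - cell a l 0 a)"
    by (rule negligible_subset[OF negligible_frontier_interval[of a "a + vec l"]]) (use sub in auto)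
qed

lemma cell_subset_cube:
  fixes a :: "real ^ 'n"
  assumes l: "l > 0" and x: "x \<in> cell a l 0 a"
  obtains P where "is_cube P" "cell a l k x \<subseteq> P" "P \<subseteq> cbox a (a + vec l)"
    "measure lebesgue P = measure lebesgue (cell a l k x)"
proof -
  define s c where "s = l / 2 ^ k" and "c = cell_corner a l k x"
  have s: "s > 0" using l by (simp add: s_def)
  note sub = box_subset_cell_subset_cbox[OF l, of a k x, folded s_def, folded c_def]
  have "cell a l k x \<subseteq> cell a l 0 x" by (rule cell_antimono) simp
  also have "\<dots> = cell a l 0 a" using x by (rule cell_eq_if_mem)
  also have "\<dots> \<subseteq> cbox a (a + vec l)" by (rule half_open_cube[OF l])
  finally have "box c (c + vec s) \<subseteq> cbox a (a + vec l)" using sub by blast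
  then have "closure (box c (c + vec s)) \<subseteq> cbox a (a + vec l)"
    by (rule closure_minimal) (rule closed_cbox)
  moreover have "box c (c + vec s) \<noteq> {}" using s by (simp add: interval_ne_empty_cart)
  ultimately have "cbox c (c + vec s) \<subseteq> cbox a (a + vec l)" by (simp add: closure_box)
  then show thesis
    using that[of "cbox c (c + vec s)"] sub s measure_cube[OF s, of c] cell_lmeasurable[OF l, of a k x]
    by (auto simp: is_cube_def s_def)
qed

section \<open>Maximal cells and the Calderon--Zygmund decomposition\<close>

text \<open>The stopping cells: the largest dyadic cells with property \<open>\<phi>\<close>, found by descending from the
  half-open version \<open>cell a l 0 a\<close> of the cube at \<open>a\<close> with side \<open>l\<close> and stopping as soon as \<open>\<phi>\<close> holds.\<close>
definition maximal_cells :: "real ^ 'n \<Rightarrow> real \<Rightarrow> ((real ^ 'n) set \<Rightarrow> bool) \<Rightarrow> (real ^ 'n) set set" where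
  "maximal_cells a l \<phi> = {cell a l k x |k x. x \<in> cell a l 0 a \<and> \<phi> (cell a l k x) \<and>
     (\<forall>j<k. \<not> \<phi> (cell a l j x))}"

lemma mem_Union_maximal_cells:
  "x \<in> cell a l 0 a \<Longrightarrow> \<phi> (cell a l k x) \<Longrightarrow> x \<in> \<Union>(maximal_cells a l \<phi>)"
proof -
  assume x: "x \<in> cell a l 0 a" and k: "\<phi> (cell a l k x)"
  define k0 where "k0 = (LEAST k. \<phi> (cell a l k x))"
  have "\<phi> (cell a l k0 x)" unfolding k0_def using k by (rule LeastI)
  moreover have "\<not> \<phi> (cell a l j x)" if "j < k0" for j
    using not_less_Least that unfolding k0_def by blast
  ultimately have "cell a l k0 x \<in> maximal_cells a l \<phi>"
    using x unfolding maximal_cells_def by blast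
  then show ?thesis using mem_cell_self by blast
qed

text \<open>Two cells that share a point are nested, and a proper ancestor of a stopping cell never has the
  stopping property.\<close>
lemma disjoint_maximal_cells: "disjoint (maximal_cells a l \<phi>)"
proof -
  have eq: "cell a l j x = cell a l k y"
    if z: "z \<in> cell a l j x" "z \<in> cell a l k y" and "j \<le> k"
      and "\<phi> (cell a l j x)" "\<forall>i<k. \<not> \<phi> (cell a l i y)" for j k x y z
  proof -
    have "z \<in> cell a l j y" using cell_antimono[OF \<open>j \<le> k\<close>] z(2) by blast
    then have "cell a l j y = cell a l j x"
      using cell_eq_if_mem[OF z(1)] cell_eq_if_mem by metis
    with that have "j = k" by (metis le_neq_implies_less)
    then show ?thesis using cell_eq_if_mem z by metis
  qed
  have "cell a l j x = cell a l k y"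
    if "\<phi> (cell a l j x)" "\<forall>i<j. \<not> \<phi> (cell a l i x)" "\<phi> (cell a l k y)" "\<forall>i<k. \<not> \<phi> (cell a l i y)"
      and z: "z \<in> cell a l j x" "z \<in> cell a l k y" for j k x y z
    using eq[OF z] eq[OF z(2,1)] that by (cases "j \<le> k") auto
  then show ?thesis
    unfolding disjoint_def maximal_cells_def by blast
qed

lemma countable_maximal_cells:
  assumes "l > 0"
  shows "countable (maximal_cells a l \<phi>)"
proof (rule countable_disjoint_nonempty_interior_subsets)
  show "pairwise disjnt (maximal_cells a l \<phi>)"
    using disjoint_maximal_cells[of a l \<phi>] by (simp add: disjoint_def pairwise_def disjnt_def)
  fix S assume "S \<in> maximal_cells a l \<phi>" "interior S = {}"
  then obtain k x where S: "S = cell a l k x" unfolding maximal_cells_def by blast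
  have "box (cell_corner a l k x) (cell_corner a l k x + vec (l / 2 ^ k)) \<subseteq> interior S"
    unfolding S by (intro interior_maximal box_subset_cell_subset_cbox(1) assms open_box)
  moreover have "box (cell_corner a l k x) (cell_corner a l k x + vec (l / 2 ^ k)) \<noteq> {}"
    using assms by (simp add: interval_ne_empty_cart)
  ultimately show "S = {}" using \<open>interior S = {}\<close> by blast
qed

text \<open>A dyadic substitute for the Lebesgue density theorem, proved directly from outer regularity. An open set
  \<open>U\<close> around \<open>S\<close> is cut into its maximal dyadic cells; those that meet \<open>S\<close> cover \<open>S\<close>, and
  summing the density bound over them gives \<open>|S| \<le> r |U|\<close>. As \<open>|U|\<close> can be taken arbitrarily close
  to \<open>|S|\<close>, this forces \<open>|S| \<le> r |S|\<close> with \<open>r < 1\<close>.\<close>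
lemma low_density_negligible:
  fixes a :: "real ^ 'n"
  assumes l: "l > 0" and S: "S \<in> lmeasurable" "S \<subseteq> cell a l 0 a" and r: "0 \<le> r" "r < 1"
    and low: "\<And>x k. x \<in> S \<Longrightarrow> measure lebesgue (S \<inter> cell a l k x) \<le> r * measure lebesgue (cell a l k x)"
  shows "negligible S"
proof -
  have le: "measure lebesgue S \<le> r * (measure lebesgue S + e)" if "e > 0" for e
  proof -
    obtain U where U: "open U" "S \<subseteq> U" "U - S \<in> lmeasurable" "emeasure lebesgue (U - S) < ennreal e"
      using sets_lebesgue_outer_open[OF fmeasurableD[OF S(1)] \<open>e > 0\<close>] by metis
    have Ulm: "U \<in> lmeasurable"
      using fmeasurable.Un[OF S(1) U(3)] U(2) by (simp add: Un_absorb1)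
    have "measure lebesgue U = measure lebesgue S + measure lebesgue (U - S)"
      using measurable_measure_Diff[OF Ulm fmeasurableD[OF S(1)] U(2)] by simp
    moreover have "measure lebesgue (U - S) < e"
      using U(3,4) that by (simp add: emeasure_eq_measure2 ennreal_less_iff)
    ultimately have mU: "measure lebesgue U < measure lebesgue S + e" by simp
    define \<C> where "\<C> = {A \<in> maximal_cells a l (\<lambda>A. A \<subseteq> U). A \<inter> S \<noteq> {}}"
    have C: "A \<in> lmeasurable \<and> A \<subseteq> U \<and> measure lebesgue (S \<inter> A) \<le> r * measure lebesgue A" if "A \<in> \<C>" for A
    proof -
      obtain k x where A: "A = cell a l k x" "A \<subseteq> U"
        using \<open>A \<in> \<C>\<close> unfolding \<C>_def maximal_cells_def by blast
      obtain z where "z \<in> A" "z \<in> S" using \<open>A \<in> \<C>\<close> unfolding \<C>_def by blast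
      then show ?thesis using low[of z k] cell_eq_if_mem[of z a l k x] A cell_lmeasurable[OF l]
        by simp
    qed
    have "S \<subseteq> (\<Union>A\<in>\<C>. S \<inter> A)"
    proof
      fix x assume x: "x \<in> S"
      obtain k where "cell a l k x \<subseteq> U" using cell_subset_open[OF l U(1)] x U(2) by blast
      then have "x \<in> \<Union>(maximal_cells a l (\<lambda>A. A \<subseteq> U))"
        using mem_Union_maximal_cells[of x a l "\<lambda>A. A \<subseteq> U" k] x S(2) by auto
      then show "x \<in> (\<Union>A\<in>\<C>. S \<inter> A)" using x unfolding \<C>_def by blast
    qed
    then have "measure lebesgue S = measure lebesgue (\<Union>A\<in>\<C>. S \<inter> A)"
      by (intro arg_cong[of _ _ "measure lebesgue"]) blast
    also have "\<dots> \<le> r * measure lebesgue (\<Union>A\<in>\<C>. A)"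
    proof (rule measure_disjoint_Union_le[OF _ _ Ulm])
      show "countable \<C>"
        by (rule countable_subset[OF _ countable_maximal_cells[OF l]]) (auto simp: \<C>_def)
      show "disjoint \<C>"
        using disjoint_maximal_cells unfolding \<C>_def disjoint_def by blast
    qed (use C S r in \<open>auto intro!: fmeasurableD fmeasurable.Int\<close>)
    also have "\<dots> \<le> r * measure lebesgue U"
    proof (intro mult_left_mono r measure_mono_fmeasurable Ulm)
      show "(\<Union>A\<in>\<C>. A) \<subseteq> U" using C by blast
      have "countable \<C>"
        by (rule countable_subset[OF _ countable_maximal_cells[OF l]]) (auto simp: \<C>_def)
      then show "(\<Union>A\<in>\<C>. A) \<in> sets lebesgue" using C by (intro sets.countable_UN') auto
    qed
    also have "\<dots> \<le> r * (measure lebesgue S + e)"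
      using mU r by (intro mult_left_mono) auto
    finally show ?thesis .
  qed
  have "measure lebesgue S \<le> r * measure lebesgue S + e" if "e > 0" for e
  proof -
    have "r * e \<le> e" using that r by (intro mult_left_le_one_le) auto
    with le[OF that] show ?thesis by (simp only: distrib_left)
  qed
  then have "measure lebesgue S \<le> r * measure lebesgue S"
    by (rule field_le_epsilon)
  then have "(1 - r) * measure lebesgue S \<le> 0" by (simp add: algebra_simps)
  then have "measure lebesgue S = 0"
    using r mult_pos_pos[of "1 - r" "measure lebesgue S"] measure_nonneg[of lebesgue S] by (smt (verit))
  then show ?thesis using S(1) by (simp add: negligible_iff_measure)
qed

text \<open>The Calderon--Zygmund decomposition of a set: stop at the first dyadic cell in which the density of \<open>E\<close>
  exceeds \<open>r\<close>. The dyadic parent has density at most \<open>r\<close> and \<open>2 ^ n\<close> times the measure, which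
  bounds the density in the stopping cell; the lower bound \<open>r\<close> bounds the total measure; and the part of
  \<open>E\<close> missed by all stopping cells has, apart from points on the boundary of \<open>Q\<close>, density at most \<open>r\<close> in every
  dyadic cell around each of its points, hence is null. Smallness of
  \<open>E\<close> ensures that the whole cube is not selected, so that every stopping cell has a parent. The members of the family are
  half-open; each comes with a closed cube \<open>P\<close> of the same measure.\<close>
lemma calderon_zygmund_cubes:
  fixes Q :: "(real ^ 'n) set"
  assumes Q: "is_cube Q" and E: "E \<in> lmeasurable" "E \<subseteq> Q" and r: "0 < r" "r < 1"
    and small: "measure lebesgue E \<le> r * measure lebesgue Q"
  obtains \<C> where "countable \<C>" "disjoint \<C>" "negligible (E - \<Union>\<C>)"
    "r * measure lebesgue (\<Union>\<C>) \<le> measure lebesgue E"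
    "\<And>A. A \<in> \<C> \<Longrightarrow> A \<in> lmeasurable \<and> measure lebesgue A > 0 \<and>
       measure lebesgue (E \<inter> A) \<le> 2 ^ CARD('n) * r * measure lebesgue A \<and>
       (\<exists>P. is_cube P \<and> A \<subseteq> P \<and> P \<subseteq> Q \<and> measure lebesgue P = measure lebesgue A)"
proof -
  obtain a l where l: "l > 0" and Qeq: "Q = cbox a (a + vec l)" using Q by (auto simp: is_cube_def)
  define \<phi> where "\<phi> = (\<lambda>A. r * measure lebesgue A < measure lebesgue (E \<inter> A))"
  define \<C> where "\<C> = maximal_cells a l \<phi>"
  note lm = cell_lmeasurable[OF l]
  have Ilm: "E \<inter> A \<in> lmeasurable" if "A \<in> lmeasurable" for A
    using that E(1) by (intro fmeasurable.Int)
  have top: "\<not> \<phi> (cell a l 0 x)" if "x \<in> cell a l 0 a" for x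
  proof -
    have "measure lebesgue (E \<inter> cell a l 0 x) \<le> measure lebesgue E"
      by (intro measure_mono_fmeasurable E fmeasurableD Ilm lm) auto
    also have "\<dots> \<le> r * measure lebesgue (cell a l 0 x)"
      using small unfolding Qeq by (simp add: lm measure_cube[OF l])
    finally show ?thesis by (simp add: \<phi>_def)
  qed
  have C: "A \<in> lmeasurable \<and> measure lebesgue A > 0 \<and> \<phi> A \<and>
       measure lebesgue (E \<inter> A) \<le> 2 ^ CARD('n) * r * measure lebesgue A \<and>
       (\<exists>P. is_cube P \<and> A \<subseteq> P \<and> P \<subseteq> Q \<and> measure lebesgue P = measure lebesgue A)"
    if "A \<in> \<C>" for A
  proof -
    obtain k x where A: "A = cell a l k x" and x: "x \<in> cell a l 0 a" and "\<phi> (cell a l k x)"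
      "\<forall>j<k. \<not> \<phi> (cell a l j x)"
      using \<open>A \<in> \<C>\<close> unfolding \<C>_def maximal_cells_def by blast
    then have k: "\<phi> A" "\<forall>j<k. \<not> \<phi> (cell a l j x)" by simp_all
    have "k \<noteq> 0" using top[OF x] k(1) A by (cases k) auto
    then obtain j where j: "k = Suc j" using not0_implies_Suc by blast
    have "measure lebesgue (E \<inter> A) \<le> measure lebesgue (E \<inter> cell a l j x)"
      unfolding A using cell_antimono[of j k a l x] j
      by (intro measure_mono_fmeasurable fmeasurableD Ilm lm) auto
    also have "\<dots> \<le> r * measure lebesgue (cell a l j x)"
      using k(2) j by (simp add: \<phi>_def not_less)
    also have "measure lebesgue (cell a l j x) = 2 ^ CARD('n) * measure lebesgue A"
      unfolding A j by (simp add: lm power_mult_distrib power_divide)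
    finally have "measure lebesgue (E \<inter> A) \<le> 2 ^ CARD('n) * r * measure lebesgue A"
      by (simp add: mult_ac)
    moreover obtain P where "is_cube P" "A \<subseteq> P" "P \<subseteq> Q" "measure lebesgue P = measure lebesgue A"
      using cell_subset_cube[OF l x, of k] unfolding A Qeq by blast
    moreover have "measure lebesgue A > 0" using l by (simp add: A lm)
    ultimately show ?thesis using k(1) lm[of a k x] A by blast
  qed
  have cnt: "countable \<C>" unfolding \<C>_def by (rule countable_maximal_cells[OF l])
  have disj: "disjoint \<C>" unfolding \<C>_def by (rule disjoint_maximal_cells)
  have UC: "\<Union>\<C> \<in> sets lebesgue" using C cnt by (intro sets.countable_Union) auto
  have "measure lebesgue (\<Union>A\<in>\<C>. A) \<le> 1 / r * measure lebesgue (\<Union>A\<in>\<C>. E \<inter> A)"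
  proof (rule measure_disjoint_Union_le[OF cnt disj])
    show "Q \<in> lmeasurable" unfolding Qeq by (rule lmeasurable_cbox)
    show "A \<subseteq> Q" if "A \<in> \<C>" for A using C[OF that] by blast
    show "measure lebesgue A \<le> 1 / r * measure lebesgue (E \<inter> A)" if "A \<in> \<C>" for A
      using C[OF that] r by (simp add: \<phi>_def field_simps)
  qed (use C Ilm r in auto)
  also have "\<dots> \<le> 1 / r * measure lebesgue E"
    using E(1) UC r by (intro mult_left_mono measure_mono_fmeasurable)
      (auto simp flip: Int_Union)
  finally have total: "r * measure lebesgue (\<Union>\<C>) \<le> measure lebesgue E"
    using r by (simp add: field_simps)
  define S where "S = E \<inter> cell a l 0 a - \<Union>\<C>"
  have "negligible S"
  proof (rule low_density_negligible[OF l _ _ _ r(2)])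
    show Slm: "S \<in> lmeasurable" unfolding S_def
      by (intro fmeasurable_Diff Ilm lm UC)
    fix x k assume x: "x \<in> S"
    then have "\<not> \<phi> (cell a l k x)"
      using mem_Union_maximal_cells[of x a l \<phi> k] unfolding S_def \<C>_def by blast
    moreover have "measure lebesgue (S \<inter> cell a l k x) \<le> measure lebesgue (E \<inter> cell a l k x)"
      by (intro measure_mono_fmeasurable fmeasurableD fmeasurable.Int Slm Ilm lm) (auto simp: S_def)
    ultimately show "measure lebesgue (S \<inter> cell a l k x) \<le> r * measure lebesgue (cell a l k x)"
      by (simp add: \<phi>_def)
  qed (use r in \<open>auto simp: S_def\<close>)
  then have "negligible (S \<union> (Q - cell a l 0 a))"
    unfolding Qeq by (intro negligible_Un half_open_cube l)
  then have "negligible (E - \<Union>\<C>)"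
    by (rule negligible_subset) (use E(2) in \<open>auto simp: S_def\<close>)
  then show thesis using that[OF cnt disj _ total] C by blast
qed

section \<open>Iterated stopping cubes\<close>

lemma local_osc_le_sharp_max:
  "is_cube Q \<Longrightarrow> x \<in> Q \<Longrightarrow> local_osc r f Q \<le> local_sharp_max r Q f x"
  unfolding local_sharp_max_def by (rule SUP_upper) simp

lemma local_sharp_max_mono:
  "P \<subseteq> Q \<Longrightarrow> local_sharp_max r P f x \<le> local_sharp_max r Q f x"
  unfolding local_sharp_max_def by (rule SUP_subset_mono) auto

lemma cube_lmeasurable_pos:
  fixes Q :: "(real ^ 'n) set"
  assumes "is_cube Q"
  shows "Q \<in> lmeasurable" "measure lebesgue Q > 0"
proof -
  obtain a l where "l > 0" "Q = cbox a (a + vec l)" using assms by (auto simp: is_cube_def)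
  then show "Q \<in> lmeasurable" "measure lebesgue Q > 0"
    using measure_cube[of l a] by (simp, metis zero_less_power)
qed

text \<open>One step of the iteration. Let \<open>E\<close> be the set where \<open>f\<close> is farther than twice the oscillation
  from the median; it has density at most \<open>r\<close> in \<open>Q\<close>. Decompose \<open>E\<close> at a height \<open>\<theta>\<close>
  above \<open>r\<close>. In each stopping cell the points outside \<open>E\<close> form a strict majority, so any
  median of the cell's closed cube stays within twice the oscillation \<^emph>\<open>on the large cube\<close> of the old median.\<close>
lemma stopping_cubes_medians_close:
  fixes f :: "real ^ 'n \<Rightarrow> real"
  defines "r \<equiv> 1 / 2 ^ (CARD('n) + 2)"
  assumes f: "f \<in> borel_measurable lebesgue" and Q: "is_cube Q" and m: "is_median f Q m"
  obtains \<C> where "countable \<C>" "disjoint \<C>"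
    "measure lebesgue (\<Union>\<C>) \<le> 2/3 * measure lebesgue Q"
    "negligible ({x \<in> Q. ennreal \<bar>f x - m\<bar> > 2 * local_osc r f Q} - \<Union>\<C>)"
    "\<And>A. A \<in> \<C> \<Longrightarrow> A \<in> lmeasurable \<and>
       (\<exists>P m'. is_cube P \<and> A \<subseteq> P \<and> P \<subseteq> Q \<and> measure lebesgue P = measure lebesgue A \<and>
          is_median f P m' \<and> ennreal \<bar>m' - m\<bar> \<le> 2 * local_osc r f Q)"
proof -
  define E where "E = {x \<in> Q. ennreal \<bar>f x - m\<bar> > 2 * local_osc r f Q}"
  \<comment> \<open>The height must satisfy \<open>2 ^ n \<theta> < 1/2\<close>, for the strict majority, and \<open>r < \<theta>\<close>, for the
    total measure of the stopping cells to be a fraction \<open>r / \<theta> < 1\<close> of \<open>|Q|\<close>. As \<open>2 ^ n r = 1/4\<close>, the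
    value \<open>2 ^ n \<theta> = 3/8\<close> halfway between works and gives the ratio \<open>2/3\<close>.\<close>
  define \<theta> :: real where "\<theta> = 3/8 / 2 ^ CARD('n)"
  have pow: "(2::real) ^ CARD('n) \<ge> 1" by simp
  have \<theta>: "0 < \<theta>" "\<theta> < 3/4"
    using divide_left_mono[OF pow, of "3/8"] unfolding \<theta>_def by simp_all
  have "r = 2/3 * \<theta>" by (simp add: r_def \<theta>_def power_add field_simps)
  with \<theta> have r: "0 \<le> r" "r < 1/2" "r = 2/3 * \<theta>" "\<theta> < 1" by simp_all
  note E = measure_exceeds_twice_osc_le[OF f cube_lmeasurable_pos[OF Q] m r(1,2), folded E_def]
  have "measure lebesgue E \<le> \<theta> * measure lebesgue Q"
    using E(2) mult_pos_pos[OF \<theta>(1) cube_lmeasurable_pos(2)[OF Q]] by (simp add: r(3))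
  moreover have "E \<subseteq> Q" by (auto simp: E_def)
  ultimately obtain \<C> where C: "countable \<C>" "disjoint \<C>" "negligible (E - \<Union>\<C>)"
    and total: "\<theta> * measure lebesgue (\<Union>\<C>) \<le> measure lebesgue E"
    and cubes: "\<And>A. A \<in> \<C> \<Longrightarrow> A \<in> lmeasurable \<and> measure lebesgue A > 0 \<and>
       measure lebesgue (E \<inter> A) \<le> 2 ^ CARD('n) * \<theta> * measure lebesgue A \<and>
       (\<exists>P. is_cube P \<and> A \<subseteq> P \<and> P \<subseteq> Q \<and> measure lebesgue P = measure lebesgue A)"
    using calderon_zygmund_cubes[OF Q E(1) _ \<theta>(1) r(4)] by metis
  have "\<theta> * measure lebesgue (\<Union>\<C>) \<le> \<theta> * (2/3 * measure lebesgue Q)"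
    using total E(2) by (simp add: r(3))
  then have size: "measure lebesgue (\<Union>\<C>) \<le> 2/3 * measure lebesgue Q"
    using \<theta>(1) by (rule mult_left_le_imp_le)
  have "A \<in> lmeasurable \<and>
       (\<exists>P m'. is_cube P \<and> A \<subseteq> P \<and> P \<subseteq> Q \<and> measure lebesgue P = measure lebesgue A \<and>
          is_median f P m' \<and> ennreal \<bar>m' - m\<bar> \<le> 2 * local_osc r f Q)" if "A \<in> \<C>" for A
  proof -
    have A: "A \<in> lmeasurable" "measure lebesgue A > 0"
      "measure lebesgue (E \<inter> A) \<le> 3/8 * measure lebesgue A"
      using cubes[OF that] by (simp_all add: \<theta>_def)
    obtain P where P: "is_cube P" "A \<subseteq> P" "P \<subseteq> Q" "measure lebesgue P = measure lebesgue A"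
      using cubes[OF \<open>A \<in> \<C>\<close>] by blast
    note Plm = cube_lmeasurable_pos[OF P(1)]
    obtain m' where m': "is_median f P m'" using median_exists[OF f Plm] by blast
    have "ennreal \<bar>m' - m\<bar> \<le> 2 * local_osc r f Q"
    proof (cases "local_osc r f Q")
      case (real w)
      have eq: "2 * local_osc r f Q = ennreal (2 * w)" using real by (simp add: ennreal_mult)
      have "measure lebesgue (A - E \<inter> A) = measure lebesgue A - measure lebesgue (E \<inter> A)"
        using A(1) E(1) by (intro measurable_measure_Diff) (auto intro: fmeasurable.Int)
      then have "measure lebesgue (A - E \<inter> A) > measure lebesgue P / 2"
        using A P(4) by simp
      moreover have "A - E \<inter> A \<in> lmeasurable"
        using A(1) E(1) by (intro fmeasurable.Diff fmeasurable.Int)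
      moreover have "\<bar>f x - m\<bar> \<le> 2 * w" if "x \<in> A - E \<inter> A" for x
      proof -
        have "\<not> ennreal \<bar>f x - m\<bar> > ennreal (2 * w)"
          using that P(2,3) unfolding E_def eq by blast
        then show ?thesis using real by (simp add: ennreal_less_iff)
      qed
      ultimately have "\<bar>m' - m\<bar> \<le> 2 * w"
        using P(2) median_close_if_majority[OF f Plm(1) m', of "A - E \<inter> A" m "2 * w"] by blast
      then show ?thesis unfolding eq by (rule ennreal_leI)
    next
      case top
      then show ?thesis by (simp add: ennreal_mult_top)
    qed
    then show ?thesis using A P m' by blast
  qed
  then show thesis using that C size unfolding E_def by blast
qed

text \<open>Iterating the step inside the stopping cubes. Each generation shrinks the exceptional set by the factor
  \<open>2/3\<close> and costs \<open>2 \<omega>(P)\<close> for some cube \<open>P\<close> with \<open>x \<in> P \<subseteq> Q\<close>, where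
  \<open>\<omega>(P)\<close> is at most the sharp maximal function at \<open>x\<close>. The induction is over all cubes and
  medians, so that its hypothesis applies to the stopping cubes; since the sharp maximal function is monotone
  in the base cube, the bounds obtained there carry over to \<open>Q\<close>.\<close>
lemma osc_bound_outside_exceptional_set:
  fixes f :: "real ^ 'n \<Rightarrow> real"
  defines "r \<equiv> 1 / 2 ^ (CARD('n) + 2)"
  assumes f: "f \<in> borel_measurable lebesgue"
  shows "is_cube Q \<Longrightarrow> is_median f Q m \<Longrightarrow>
    \<exists>\<Omega> \<in> lmeasurable. measure lebesgue \<Omega> \<le> (2/3) ^ k * measure lebesgue Q \<and>
      (\<forall>x \<in> Q - \<Omega>. ennreal \<bar>f x - m\<bar> \<le> ennreal (2 * real k) * local_sharp_max r Q f x)"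
proof (induction k arbitrary: Q m)
  case 0
  then show ?case using cube_lmeasurable_pos[of Q] by (intro bexI[of _ Q]) auto
next
  case (Suc k)
  note Q = \<open>is_cube Q\<close>
  define E where "E = {x \<in> Q. ennreal \<bar>f x - m\<bar> > 2 * local_osc r f Q}"
  obtain \<C> where C: "countable \<C>" "disjoint \<C>"
    and size: "measure lebesgue (\<Union>\<C>) \<le> 2/3 * measure lebesgue Q"
    and null: "negligible (E - \<Union>\<C>)"
    and cubes: "\<And>A. A \<in> \<C> \<Longrightarrow> A \<in> lmeasurable \<and>
       (\<exists>P m'. is_cube P \<and> A \<subseteq> P \<and> P \<subseteq> Q \<and> measure lebesgue P = measure lebesgue A \<and>
          is_median f P m' \<and> ennreal \<bar>m' - m\<bar> \<le> 2 * local_osc r f Q)"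
    by (rule stopping_cubes_medians_close[OF f Suc.prems, folded r_def, folded E_def]) (rule that)
  have "\<exists>\<Omega> \<in> lmeasurable. measure lebesgue \<Omega> \<le> (2/3) ^ k * measure lebesgue A \<and>
      (\<forall>x \<in> A - \<Omega>. ennreal \<bar>f x - m\<bar> \<le> ennreal (2 * real (Suc k)) * local_sharp_max r Q f x)"
    if "A \<in> \<C>" for A
  proof -
    obtain P m' where P: "is_cube P" "A \<subseteq> P" "P \<subseteq> Q" "measure lebesgue P = measure lebesgue A"
      and m': "is_median f P m'" "ennreal \<bar>m' - m\<bar> \<le> 2 * local_osc r f Q"
      using cubes[OF \<open>A \<in> \<C>\<close>] by blast
    obtain \<Omega> where \<Omega>: "\<Omega> \<in> lmeasurable" "measure lebesgue \<Omega> \<le> (2/3) ^ k * measure lebesgue P"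
      and good: "\<And>x. x \<in> P - \<Omega> \<Longrightarrow> ennreal \<bar>f x - m'\<bar> \<le> ennreal (2 * real k) * local_sharp_max r P f x"
      using Suc.IH[OF P(1) m'(1)] by blast
    have "ennreal \<bar>f x - m\<bar> \<le> ennreal (2 * real (Suc k)) * local_sharp_max r Q f x" if x: "x \<in> A - \<Omega>" for x
    proof -
      define M where "M = local_sharp_max r Q f x"
      have "ennreal \<bar>f x - m\<bar> \<le> ennreal (\<bar>f x - m'\<bar> + \<bar>m' - m\<bar>)"
        by (rule ennreal_leI) linarith
      also have "\<dots> = ennreal \<bar>f x - m'\<bar> + ennreal \<bar>m' - m\<bar>" by simp
      also have "\<dots> \<le> ennreal (2 * real k) * M + 2 * M"
      proof (rule add_mono)
        have "ennreal \<bar>f x - m'\<bar> \<le> ennreal (2 * real k) * local_sharp_max r P f x"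
          using x P(2) by (intro good) auto
        also have "\<dots> \<le> ennreal (2 * real k) * M"
          unfolding M_def by (intro mult_left_mono local_sharp_max_mono P) simp
        finally show "ennreal \<bar>f x - m'\<bar> \<le> ennreal (2 * real k) * M" .
        have "2 * local_osc r f Q \<le> 2 * M"
          unfolding M_def using x P(2,3) by (intro mult_left_mono local_osc_le_sharp_max Q) auto
        with m'(2) show "ennreal \<bar>m' - m\<bar> \<le> 2 * M" by (rule order_trans)
      qed
      also have "\<dots> = (ennreal (2 * real k) + ennreal 2) * M"
        by (simp add: distrib_right)
      also have "ennreal (2 * real k) + ennreal 2 = ennreal (2 * real (Suc k))"
        by (simp flip: ennreal_plus add: algebra_simps del: ennreal_numeral)
      finally show ?thesis unfolding M_def .
    qed
    then show ?thesis using \<Omega> P(4) by auto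
  qed
  then obtain W where W: "\<And>A. A \<in> \<C> \<Longrightarrow> W A \<in> lmeasurable"
    "\<And>A. A \<in> \<C> \<Longrightarrow> measure lebesgue (W A) \<le> (2/3) ^ k * measure lebesgue A"
    and good: "\<And>A x. A \<in> \<C> \<Longrightarrow> x \<in> A - W A \<Longrightarrow>
      ennreal \<bar>f x - m\<bar> \<le> ennreal (2 * real (Suc k)) * local_sharp_max r Q f x"
    by metis
  \<comment> \<open>Each \<open>W A\<close> is cut down to its own cell, so that the pieces are disjoint and their measures add.\<close>
  define V where "V = (\<Union>A\<in>\<C>. W A \<inter> A)"
  define \<Omega> where "\<Omega> = V \<union> (E - \<Union>\<C>)"
  have WA: "W A \<inter> A \<in> lmeasurable" if "A \<in> \<C>" for A
    using W(1) cubes that by (blast intro: fmeasurable.Int)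
  have V: "V \<in> lmeasurable"
  proof (rule fmeasurableI2[OF cube_lmeasurable_pos(1)[OF Q]])
    show "V \<subseteq> Q" using cubes unfolding V_def by blast
    show "V \<in> sets lebesgue" unfolding V_def using C(1) WA by (intro sets.countable_UN') auto
  qed
  have "measure lebesgue V \<le> (2/3) ^ k * measure lebesgue (\<Union>A\<in>\<C>. A)"
    unfolding V_def
  proof (rule measure_disjoint_Union_le[OF C cube_lmeasurable_pos(1)[OF Q]])
    show "A \<subseteq> Q" if "A \<in> \<C>" for A using cubes[OF \<open>A \<in> \<C>\<close>] by blast
    show "measure lebesgue (W A \<inter> A) \<le> (2/3) ^ k * measure lebesgue A" if "A \<in> \<C>" for A
    proof -
      have "measure lebesgue (W A \<inter> A) \<le> measure lebesgue (W A)"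
        by (intro measure_mono_fmeasurable W fmeasurableD WA that) auto
      with W(2)[OF that] show ?thesis by linarith
    qed
    show "W A \<inter> A \<in> sets lebesgue \<and> W A \<inter> A \<subseteq> A" if "A \<in> \<C>" for A
      using WA[OF that] by auto
    show "A \<in> sets lebesgue \<and> A \<subseteq> A" if "A \<in> \<C>" for A
      using cubes[OF that] by (simp add: fmeasurableD)
  qed simp
  also have "\<dots> \<le> (2/3) ^ k * (2/3 * measure lebesgue Q)"
    using size by (intro mult_left_mono) auto
  finally have "measure lebesgue V \<le> (2/3) ^ Suc k * measure lebesgue Q" by simp
  moreover have "\<Omega> \<in> lmeasurable" "measure lebesgue \<Omega> = measure lebesgue V"
  proof -
    have sd: "negligible (sym_diff V \<Omega>)"
      by (rule negligible_subset[OF null]) (auto simp: \<Omega>_def)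
    show "\<Omega> \<in> lmeasurable" by (rule lmeasurable_negligible_symdiff[OF V sd])
    show "measure lebesgue \<Omega> = measure lebesgue V" by (rule measure_negligible_symdiff[OF V sd])
  qed
  moreover have "ennreal \<bar>f x - m\<bar> \<le> ennreal (2 * real (Suc k)) * local_sharp_max r Q f x"
    if x: "x \<in> Q - \<Omega>" for x
  proof (cases "x \<in> \<Union>\<C>")
    case True
    then obtain A where "A \<in> \<C>" "x \<in> A" by blast
    moreover from this have "x \<notin> W A" using x unfolding \<Omega>_def V_def by blast
    ultimately show ?thesis using good by blast
  next
    case False
    then have "\<not> ennreal \<bar>f x - m\<bar> > 2 * local_osc r f Q"
      using x unfolding \<Omega>_def E_def by blast
    then have "ennreal \<bar>f x - m\<bar> \<le> ennreal 2 * local_osc r f Q" by simp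
    also have "\<dots> \<le> ennreal (2 * real (Suc k)) * local_sharp_max r Q f x"
      using x by (intro mult_mono ennreal_leI local_osc_le_sharp_max Q) auto
    finally show ?thesis .
  qed
  ultimately show ?case by (intro bexI[of _ \<Omega>]) auto
qed

section \<open>Exponential decay\<close>

theorem theorem2p1:
  shows "\<exists>\<alpha> c :: real. \<alpha> > 0 \<and> c > 0 \<and>
    (\<forall>(Q :: (real ^ 'n) set) f m t.
       is_cube Q \<longrightarrow> f \<in> Linf_c \<longrightarrow> ess_support f \<subseteq> Q \<longrightarrow> is_median f Q m \<longrightarrow> t > 0 \<longrightarrow>
       measure lebesgue {x \<in> Q. ennreal \<bar>f x - m\<bar> >
           ennreal t * local_sharp_max (1 / 2 ^ (CARD('n) + 2)) Q f x}
         \<le> c * exp (- \<alpha> * t) * measure lebesgue Q)"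
proof (rule exI[of _ "ln (3/2) / 2"], rule exI[of _ "3/2"], intro conjI allI impI)
  fix Q :: "(real ^ 'n) set" and f m t
  assume Q: "is_cube Q" and f: "f \<in> Linf_c" and m: "is_median f Q m" and t: "(t::real) > 0"
  \<comment> \<open>The largest number of generations whose total cost \<open>2 k\<close> does not exceed \<open>t\<close>. Then
    \<open>k > t/2 - 1\<close>, so \<open>(2/3) ^ k\<close> decays like \<open>exp (- \<alpha> t)\<close> with \<open>\<alpha> = ln (3/2) / 2\<close>, and the
    rounding costs the factor \<open>3/2\<close>.\<close>
  define k where "k = nat \<lfloor>t / 2\<rfloor>"
  have k: "2 * real k \<le> t" "t / 2 < real k + 1"
    using t by (simp_all add: k_def) linarith+
  let ?M = "local_sharp_max (1 / 2 ^ (CARD('n) + 2)) Q f"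
  let ?X = "{x \<in> Q. ennreal \<bar>f x - m\<bar> > ennreal t * ?M x}"
  have f': "f \<in> borel_measurable lebesgue" using f by (simp add: Linf_c_def)
  obtain \<Omega> where \<Omega>: "\<Omega> \<in> lmeasurable" "measure lebesgue \<Omega> \<le> (2/3) ^ k * measure lebesgue Q"
    and good: "\<And>x. x \<in> Q - \<Omega> \<Longrightarrow> ennreal \<bar>f x - m\<bar> \<le> ennreal (2 * real k) * ?M x"
    using osc_bound_outside_exceptional_set[OF f' Q m, of k] by blast
  have "?X \<subseteq> \<Omega>"
  proof
    fix x assume x: "x \<in> ?X"
    show "x \<in> \<Omega>"
    proof (rule ccontr)
      assume "x \<notin> \<Omega>"
      then have "ennreal \<bar>f x - m\<bar> \<le> ennreal (2 * real k) * ?M x" using x by (intro good) auto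
      also have "\<dots> \<le> ennreal t * ?M x" using k(1) by (intro mult_right_mono ennreal_leI) auto
      finally show False using x by auto
    qed
  qed
  \<comment> \<open>Should the left-hand set be non-measurable, the bound is trivial: a set outside the \<open>\<sigma>\<close>-algebra has
    \<open>measure\<close> zero by convention.\<close>
  then have "measure lebesgue ?X \<le> measure lebesgue \<Omega>"
    using \<Omega>(1) by (cases "?X \<in> sets lebesgue")
      (auto intro: measure_mono_fmeasurable simp: measure_notin_sets)
  also have "\<dots> \<le> (2/3) ^ k * measure lebesgue Q" by (rule \<Omega>(2))
  also have "(2/3::real) ^ k \<le> 3/2 * exp (- (ln (3/2) / 2) * t)"
  proof -
    have "(2/3::real) ^ k = exp (real k * ln (2/3))" by (simp add: exp_of_nat_mult)
    also have "ln (2/3::real) = - ln (3/2)" using ln_inverse[of "3/2::real"] by simp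
    also have "exp (real k * - ln (3/2)) \<le> exp (ln (3/2) + - (ln (3/2) / 2) * t)"
    proof -
      have "(t / 2) * ln (3/2) \<le> (real k + 1) * ln (3/2)"
        using k(2) by (intro mult_right_mono) auto
      then show ?thesis by (simp add: algebra_simps)
    qed
    also have "\<dots> = 3/2 * exp (- (ln (3/2) / 2) * t)" by (subst exp_add) simp
    finally show ?thesis .
  qed
  finally show "measure lebesgue ?X \<le> 3/2 * exp (- (ln (3/2) / 2) * t) * measure lebesgue Q"
    by (simp add: mult_right_mono)
qed auto

end
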